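(* Let $X$ be a uniformly ergodic time-homogeneous Markov chain on $\mathcal{X}$ under $\mathbb{P}$ with transition matrix $A$, let $\gamma\in(0,1)$, and let $f:\mathcal{X}\times\mathbb{R}^N\to\mathbb{R}$ be such that the driver $(\omega,t,z)\mapsto f(X_t(\omega),z)$ is $\gamma$-balanced. Let $(Y,Z,\lambda)=(v(X_t),\mathbf{v},\lambda)$ be the bounded, stationary, Markovian solution of the Ergodic BSDE $$Y_T=Y_t-\sum_{t\le u<T}\big(f(X_u,Z_u)-\lambda\big)+\sum_{t\le u<T}Z_u^{*}M_{u+1}\quad\text{a.s. for all }0\le t<T<\infty,$$ where $v:\mathcal{X}\to\mathbb{R}$ and $\mathbf{v}\in\mathbb{R}^N$ is the vector with entries $e_k^*\mathbf{v}=v(e_k)$. Let $\pi$ denote the ergodic measure of $X$ under $\mathbb{P}$. Then $$\lambda=\int_{\mathcal{X}}f(x,\mathbf{v})\,d\pi(x)=\sum_{x\in\mathcal{X}}f(x,\mathbf{v})\,\pi(\{x\}).$$ Furthermore, there exists a probability measure $\pi_{\mathbf{v}}$ on $\mathcal{X}$ such that $$\lambda=\int_{\mathcal{X}}f(x,0)\,d\pi_{\mathbf{v}}(x).$$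
   Context: Setting. $\mathcal{X}=\{e_1,\dots,e_N\}$ is the standard basis of $\mathbb{R}^N$ (column vectors; $*$ is transposition), $X=(X_t)_{t\ge0}$ is an $\mathcal{X}$-valued process in discrete time $t\in\{0,1,2,\dots\}$ on a probability space $(\Omega,\mathcal{F},\mathbb{P})$, $\mathcal{F}_t$ is the $\mathbb{P}$-completion of $\sigma(X_0,\dots,X_t)$ (adding only subsets of null sets of $\sigma(X_0,\dots,X_t)$), and $\mathcal{F}=\sigma(\bigcup_t\mathcal{F}_t)$. Transition matrices are column-stochastic: $A=[a_{ij}]$, $a_{ij}=\mathbb{P}(X_{t+1}=e_i\mid X_t=e_j)$. Put $M_{t+1}:=X_{t+1}-AX_t$. Uniform ergodicity: with $P_t\mu$ the law of $X_t$ given $X_0\sim\mu$, the chain is uniformly ergodic if there are a probability measure $\pi$ on $\mathcal{X}$ and $R,\rho>0$ with $\sup_\mu\|P_t\mu-\pi\|_{TV}\le Re^{-\rho t}$ for all $t\ge0$ (supremum over probability measures on $\mathcal{X}$; $\|\mu\|_{TV}=\frac12\sum_{x}|\mu(\{x\})|$). Then $\pi$ is the unique invariant measure, called the ergodic measure. $\gamma$-balanced: a driver $f(\omega,t,z)$ (adapted: $(\omega,z)\mapsto f(\omega,t,z)$ is $\mathcal{F}_t\otimes\mathcal{B}(\mathbb{R}^N)$-measurable for each $t$) is $\gamma$-balanced if there is a map $\psi:\Omega\times\mathbb{N}\times\mathbb{R}^N\times\mathbb{R}^N\to\mathbb{R}^N$, adapted in the same sense, such that for all $t\ge0$, $z,z'\in\mathbb{R}^N$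 and almost all $\omega$: (i) $f(\omega,t,z)-f(\omega,t,z')=(z-z')^*(\psi(\omega,t,z,z')-AX_t)$; (ii) for each $i$, $\frac{e_i^*\psi(\omega,t,z,z')}{e_i^*AX_t}\in[\gamma,\gamma^{-1}]$, with $0/0:=1$; (iii) the entries of $\psi(\omega,t,z,z')$ sum to $1$. Under these assumptions a bounded, stationary, Markovian solution of the form $(v(X_t),\mathbf{v},\lambda)$ exists, with $\lambda$ unique. *)

theory Defs
  imports "HOL-Probability.Probability"
begin

definition state_space :: "(real ^ 'n) set"
  where "state_space = range (\<lambda>i. axis i 1)"

definition prob_on_states :: "(real ^ 'n) measure \<Rightarrow> bool"
  where "prob_on_states \<mu> \<longleftrightarrow> prob_space \<mu> \<and> sets \<mu> = Pow state_space"

definition column_stochastic :: "real ^ 'n ^ 'n \<Rightarrow> bool"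
  where "column_stochastic A \<longleftrightarrow> (\<forall>i j. 0 \<le> A $ i $ j) \<and> (\<forall>j. (\<Sum>i\<in>UNIV. A $ i $ j) = 1)"

definition past :: "'w measure \<Rightarrow> (nat \<Rightarrow> 'w \<Rightarrow> real ^ 'n) \<Rightarrow> nat \<Rightarrow> 'w measure"
  where "past M X t =
    sigma (space M) {X s -` B \<inter> space M | s B. s \<le> t \<and> B \<in> sets borel}"

text \<open>The completion adds only subsets of null sets belonging to the sigma-algebra generated by
  \<open>X 0, \<dots>, X t\<close> itself, not subsets of arbitrary null sets of \<open>M\<close>.\<close>

definition filt :: "'w measure \<Rightarrow> (nat \<Rightarrow> 'w \<Rightarrow> real ^ 'n) \<Rightarrow> nat \<Rightarrow> 'w measure"
  where "filt M X t = completion (restr_to_subalg M (past M X t))"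

definition state_process :: "'w measure \<Rightarrow> (nat \<Rightarrow> 'w \<Rightarrow> real ^ 'n) \<Rightarrow> bool"
  where "state_process M X \<longleftrightarrow>
    prob_space M \<and>
    (\<forall>t. X t \<in> borel_measurable M) \<and>
    (\<forall>t. \<forall>\<omega>\<in>space M. X t \<omega> \<in> state_space) \<and>
    sets M = sigma_sets (space M) (\<Union>t. sets (filt M X t))"

text \<open>Entry \<open>A $ i $ j\<close> is the probability of a jump from state \<open>j\<close> to state \<open>i\<close>. The Markov
  property is stated for all histories of positive probability, with \<open>k s\<close> the index of the
  state at time \<open>s\<close>.\<close>

definition markov_chain ::
    "'w measure \<Rightarrow> (nat \<Rightarrow> 'w \<Rightarrow> real ^ 'n) \<Rightarrow> real ^ 'n ^ 'n \<Rightarrow> bool"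
  where "markov_chain M X A \<longleftrightarrow>
    state_process M X \<and> column_stochastic A \<and>
    (\<forall>t i. \<forall>k :: nat \<Rightarrow> 'n.
       0 < \<P>(\<omega> in M. \<forall>s\<le>t. X s \<omega> = axis (k s) 1) \<longrightarrow>
       \<P>(\<omega> in M. X (Suc t) \<omega> = axis i 1 \<bar> \<forall>s\<le>t. X s \<omega> = axis (k s) 1) = A $ i $ k t)"

text \<open>The law at time \<open>t\<close> of the chain with transition matrix \<open>A\<close> and initial law \<open>\<mu>\<close>. For
  states \<open>x = axis i 1\<close> and \<open>y = axis j 1\<close>, the number \<open>x \<bullet> (A *v y)\<close> is \<open>A $ i $ j\<close>.\<close>

primrec chain_law :: "real ^ 'n ^ 'n \<Rightarrow> nat \<Rightarrow> (real ^ 'n) measure \<Rightarrow> (real ^ 'n) measure"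
  where
    "chain_law A 0 \<mu> = \<mu>"
  | "chain_law A (Suc t) \<mu> =
       point_measure state_space
         (\<lambda>x. ennreal (\<Sum>y\<in>state_space. (x \<bullet> (A *v y)) * measure (chain_law A t \<mu>) {y}))"

lemma finite_state_space [simp]: "finite (state_space :: (real ^ 'n) set)"
  by (simp add: state_space_def)

lemma axis_in_state_space [simp]: "axis i 1 \<in> (state_space :: (real ^ 'n) set)"
  by (simp add: state_space_def)

lemma axis_one_eq_iff [simp]: "(axis i 1 :: real ^ 'n) = axis j 1 \<longleftrightarrow> i = j"
  by (simp add: axis_eq_axis)

lemma inj_axis_one: "inj (\<lambda>i. axis i 1 :: real ^ 'n)"
  by (simp add: inj_def)

lemma axis_entry: "(axis i 1 :: real ^ 'n) \<bullet> (A *v axis j 1) = A $ i $ j"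
  by (simp add: inner_axis' matrix_vector_mult_basis column_def)

lemma markov_chain_step:
  fixes X :: "nat \<Rightarrow> 'w \<Rightarrow> real ^ 'n"
  assumes "markov_chain M X A"
  shows "\<P>(\<omega> in M. X (Suc t) \<omega> = axis i 1) =
    (\<Sum>j\<in>UNIV. A $ i $ j * \<P>(\<omega> in M. X t \<omega> = axis j 1))"
proof -
  from assms have sp: "state_process M X"
    and mk: "\<And>t i k. 0 < \<P>(\<omega> in M. \<forall>s\<le>t. X s \<omega> = axis (k s) 1) \<Longrightarrow>
       \<P>(\<omega> in M. X (Suc t) \<omega> = axis i 1 \<bar> \<forall>s\<le>t. X s \<omega> = axis (k s) 1) = A $ i $ k t"
    unfolding markov_chain_def by blast+
  interpret prob_space M using sp by (simp add: state_process_def)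
  have meas [measurable]: "\<And>t. X t \<in> borel_measurable M"
    and st: "\<And>t \<omega>. \<omega> \<in> space M \<Longrightarrow> X t \<omega> \<in> state_space"
    using sp by (auto simp: state_process_def)
  define H where "H = (PiE {..t} (\<lambda>_. UNIV) :: (nat \<Rightarrow> 'n) set)"
  define E where "E k = {\<omega> \<in> space M. \<forall>s\<le>t. X s \<omega> = axis (k s) 1}" for k :: "nat \<Rightarrow> 'n"
  have finH: "finite H" unfolding H_def by (intro finite_PiE) auto
  have Em [measurable]: "E k \<in> sets M" for k unfolding E_def by measurable
  have disj: "disjoint_family_on E H"
  proof (unfold disjoint_family_on_def, intro ballI impI)
    fix k l assume kl: "k \<in> H" "l \<in> H" "k \<noteq> l"
    show "E k \<inter> E l = {}"
    proof (rule ccontr)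
      assume "E k \<inter> E l \<noteq> {}"
      then obtain \<omega> where "\<omega> \<in> E k" "\<omega> \<in> E l" by blast
      then have "\<forall>s\<le>t. (axis (k s) 1 :: real ^ 'n) = axis (l s) 1" unfolding E_def by force
      then have "\<And>s. s \<in> {..t} \<Longrightarrow> k s = l s" by auto
      with kl show False unfolding H_def by (meson PiE_ext)
    qed
  qed
  have cover: "\<exists>k\<in>H. \<omega> \<in> E k" if "\<omega> \<in> space M" for \<omega>
  proof -
    have "\<forall>s. \<exists>j. X s \<omega> = axis j 1" using st[OF that] by (auto simp: state_space_def)
    then obtain j where j: "\<And>s. X s \<omega> = axis (j s) 1" by metis
    show ?thesis
      by (rule bexI[of _ "restrict j {..t}"]) (auto simp: H_def E_def j that)
  qed
  have split: "prob S = (\<Sum>k\<in>H. prob (S \<inter> E k))" if "S \<in> sets M" for S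
  proof -
    have "S = (\<Union>k\<in>H. S \<inter> E k)" using cover sets.sets_into_space[OF that] by blast
    moreover have "prob (\<Union>k\<in>H. S \<inter> E k) = (\<Sum>k\<in>H. prob (S \<inter> E k))"
      using disj that
      by (intro finite_measure_finite_Union finH) (auto simp: disjoint_family_on_def)
    ultimately show ?thesis by simp
  qed
  have step: "prob ({\<omega> \<in> space M. X (Suc t) \<omega> = axis i 1} \<inter> E k) = A $ i $ k t * prob (E k)"
    if "k \<in> H" for k
  proof (cases "prob (E k) = 0")
    case True
    have "prob ({\<omega> \<in> space M. X (Suc t) \<omega> = axis i 1} \<inter> E k) \<le> prob (E k)"
      by (intro finite_measure_mono) auto
    with True show ?thesis by (simp add: measure_le_0_iff)
  next
    case False
    then have pos: "0 < prob (E k)" by (simp add: zero_less_measure_iff)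
    have "{\<omega> \<in> space M. X (Suc t) \<omega> = axis i 1 \<and> (\<forall>s\<le>t. X s \<omega> = axis (k s) 1)} =
        {\<omega> \<in> space M. X (Suc t) \<omega> = axis i 1} \<inter> E k"
      by (auto simp: E_def)
    with mk[of t k i] pos show ?thesis
      by (simp add: cond_prob_def E_def[symmetric] field_simps)
  qed
  have now: "prob ({\<omega> \<in> space M. X t \<omega> = axis j 1} \<inter> E k) = (if k t = j then prob (E k) else 0)"
    for j k
  proof (cases "k t = j")
    case True
    then have "{\<omega> \<in> space M. X t \<omega> = axis j 1} \<inter> E k = E k" by (auto simp: E_def)
    with True show ?thesis by simp
  next
    case False
    then have "{\<omega> \<in> space M. X t \<omega> = axis j 1} \<inter> E k = {}" by (force simp: E_def)
    with False show ?thesis by simp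
  qed
  have "prob {\<omega> \<in> space M. X (Suc t) \<omega> = axis i 1} = (\<Sum>k\<in>H. A $ i $ k t * prob (E k))"
    by (subst split) (auto simp: step)
  also have "\<dots> = (\<Sum>k\<in>H. \<Sum>j\<in>UNIV. A $ i $ j * (if k t = j then prob (E k) else 0))"
    by (simp add: if_distrib cong: if_cong)
  also have "\<dots> = (\<Sum>j\<in>UNIV. A $ i $ j * prob {\<omega> \<in> space M. X t \<omega> = axis j 1})"
    by (subst sum.swap, subst split) (auto simp: now sum_distrib_left)
  finally show ?thesis .
qed

lemma distr_eq_chain_law:
  fixes X :: "nat \<Rightarrow> 'w \<Rightarrow> real ^ 'n"
  assumes "markov_chain M X A"
  shows "distr M (count_space state_space) (X t) =
    chain_law A t (distr M (count_space state_space) (X 0))"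
proof (induction t)
  case 0
  show ?case by simp
next
  case (Suc t)
  from assms have sp: "state_process M X" and cs: "column_stochastic A"
    unfolding markov_chain_def by blast+
  interpret prob_space M using sp by (simp add: state_process_def)
  have meas [measurable]: "\<And>t. X t \<in> borel_measurable M"
    and st: "\<And>t \<omega>. \<omega> \<in> space M \<Longrightarrow> X t \<omega> \<in> state_space"
    using sp by (auto simp: state_process_def)
  have mc: "X t \<in> measurable M (count_space state_space)" for t
    unfolding measurable_count_space_eq2[OF finite_state_space]
  proof (intro conjI ballI)
    show "X t \<in> space M \<rightarrow> state_space" using st by auto
    show "X t -` {a} \<inter> space M \<in> sets M" for a by measurable
  qed
  have vm: "X t -` {a} \<inter> space M = {\<omega> \<in> space M. X t \<omega> = a}" for t a by auto
  have law: "measure (distr M (count_space state_space) (X t)) {axis j 1} =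
      prob {\<omega> \<in> space M. X t \<omega> = axis j 1}" for t and j :: 'n
    using mc by (subst measure_distr) (auto simp: vm)
  show ?case
  proof (rule measure_eqI_finite)
    show "sets (distr M (count_space state_space) (X (Suc t))) = Pow state_space" by simp
    show "sets (chain_law A (Suc t) (distr M (count_space state_space) (X 0))) = Pow state_space"
      by (simp add: sets_point_measure)
    show "finite (state_space :: (real ^ 'n) set)" by simp
    fix a :: "real ^ 'n" assume "a \<in> state_space"
    then obtain i where i: "a = axis i 1" by (auto simp: state_space_def)
    have "emeasure (distr M (count_space state_space) (X (Suc t))) {a} =
        ennreal (prob {\<omega> \<in> space M. X (Suc t) \<omega> = axis i 1})"
      using mc i by (subst emeasure_distr) (auto simp: vm emeasure_eq_measure)
    also have "prob {\<omega> \<in> space M. X (Suc t) \<omega> = axis i 1} =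
        (\<Sum>y\<in>state_space. (a \<bullet> (A *v y)) * measure (distr M (count_space state_space) (X t)) {y})"
      unfolding markov_chain_step[OF assms]
      by (simp add: state_space_def sum.reindex[OF inj_axis_one] i axis_entry
          law[unfolded state_space_def])
    also have "ennreal \<dots> =
        emeasure (chain_law A (Suc t) (distr M (count_space state_space) (X 0))) {a}"
      using i by (simp add: emeasure_point_measure_finite Suc.IH[symmetric])
    finally show "emeasure (distr M (count_space state_space) (X (Suc t))) {a} =
        emeasure (chain_law A (Suc t) (distr M (count_space state_space) (X 0))) {a}" .
  qed
qed

definition tv_dist :: "(real ^ 'n) measure \<Rightarrow> (real ^ 'n) measure \<Rightarrow> real"
  where "tv_dist \<mu> \<nu> = (1 / 2) * (\<Sum>x\<in>state_space. \<bar>measure \<mu> {x} - measure \<nu> {x}\<bar>)"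

text \<open>The bound for every initial law \<open>\<mu>\<close>, with constants not depending on \<open>\<mu>\<close>, is the bound
  on the supremum over \<open>\<mu>\<close>.\<close>

definition ergodic_measure :: "real ^ 'n ^ 'n \<Rightarrow> (real ^ 'n) measure \<Rightarrow> bool"
  where "ergodic_measure A \<pi> \<longleftrightarrow>
    prob_on_states \<pi> \<and>
    (\<exists>R \<rho>. 0 < R \<and> 0 < \<rho> \<and>
      (\<forall>t \<mu>. prob_on_states \<mu> \<longrightarrow>
        tv_dist (chain_law A t \<mu>) \<pi> \<le> R * exp (- \<rho> * real t)))"

definition uniformly_ergodic :: "real ^ 'n ^ 'n \<Rightarrow> bool"
  where "uniformly_ergodic A \<longleftrightarrow> (\<exists>\<pi>. ergodic_measure A \<pi>)"

definition adapted_driver ::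
    "'w measure \<Rightarrow> (nat \<Rightarrow> 'w \<Rightarrow> real ^ 'n) \<Rightarrow> ('w \<Rightarrow> nat \<Rightarrow> real ^ 'n \<Rightarrow> real) \<Rightarrow> bool"
  where "adapted_driver M X F \<longleftrightarrow>
    (\<forall>t. (\<lambda>(\<omega>, z). F \<omega> t z) \<in> borel_measurable (filt M X t \<Otimes>\<^sub>M borel))"

text \<open>For \<open>a \<noteq> 0\<close> the HOL value \<open>a / 0 = 0\<close> lies outside \<open>{\<gamma>..1 / \<gamma>}\<close> when \<open>\<gamma> > 0\<close>, so a
  ratio \<open>a / 0\<close> in that interval forces \<open>a = 0\<close>, as it should.\<close>

definition ratio :: "real \<Rightarrow> real \<Rightarrow> real"
  where "ratio a b = (if a = 0 \<and> b = 0 then 1 else a / b)"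

definition gamma_balanced ::
    "'w measure \<Rightarrow> (nat \<Rightarrow> 'w \<Rightarrow> real ^ 'n) \<Rightarrow> real ^ 'n ^ 'n \<Rightarrow> real \<Rightarrow>
     ('w \<Rightarrow> nat \<Rightarrow> real ^ 'n \<Rightarrow> real) \<Rightarrow> bool"
  where "gamma_balanced M X A \<gamma> F \<longleftrightarrow>
    adapted_driver M X F \<and>
    (\<exists>\<psi> :: 'w \<Rightarrow> nat \<Rightarrow> real ^ 'n \<Rightarrow> real ^ 'n \<Rightarrow> real ^ 'n.
      (\<forall>t. (\<lambda>(\<omega>, z, z'). \<psi> \<omega> t z z')
             \<in> borel_measurable (filt M X t \<Otimes>\<^sub>M (borel \<Otimes>\<^sub>M borel))) \<and>
      (\<forall>t z z'. AE \<omega> in M.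
        F \<omega> t z - F \<omega> t z' = (z - z') \<bullet> (\<psi> \<omega> t z z' - A *v X t \<omega>) \<and>
        (\<forall>i. ratio (axis i 1 \<bullet> \<psi> \<omega> t z z') (axis i 1 \<bullet> (A *v X t \<omega>)) \<in> {\<gamma>..1 / \<gamma>}) \<and>
        (\<Sum>i\<in>UNIV. \<psi> \<omega> t z z' $ i) = 1))"

text \<open>The increment \<open>M_{u+1} = X_{u+1} - A X_u\<close>, indexed here by \<open>u\<close>.\<close>

definition mart_incr ::
    "real ^ 'n ^ 'n \<Rightarrow> (nat \<Rightarrow> 'w \<Rightarrow> real ^ 'n) \<Rightarrow> nat \<Rightarrow> 'w \<Rightarrow> real ^ 'n"
  where "mart_incr A X u \<omega> = X (Suc u) \<omega> - A *v X u \<omega>"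

definition ebsde_solution ::
    "'w measure \<Rightarrow> (nat \<Rightarrow> 'w \<Rightarrow> real ^ 'n) \<Rightarrow> real ^ 'n ^ 'n \<Rightarrow>
     ('w \<Rightarrow> nat \<Rightarrow> real ^ 'n \<Rightarrow> real) \<Rightarrow>
     (nat \<Rightarrow> 'w \<Rightarrow> real) \<Rightarrow> (nat \<Rightarrow> 'w \<Rightarrow> real ^ 'n) \<Rightarrow> real \<Rightarrow> bool"
  where "ebsde_solution M X A F Y Z lam \<longleftrightarrow>
    (\<forall>t. Y t \<in> borel_measurable (filt M X t)) \<and>
    (\<forall>t. Z t \<in> borel_measurable (filt M X t)) \<and>
    (\<forall>t T. t < T \<longrightarrow> (AE \<omega> in M.
      Y T \<omega> = Y t \<omega> - (\<Sum>u\<in>{t..<T}. F \<omega> u (Z u \<omega>) - lam)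
                    + (\<Sum>u\<in>{t..<T}. Z u \<omega> \<bullet> mart_incr A X u \<omega>)))"

definition bounded_process :: "'w measure \<Rightarrow> (nat \<Rightarrow> 'w \<Rightarrow> real) \<Rightarrow> bool"
  where "bounded_process M Y \<longleftrightarrow> (\<exists>C. \<forall>t. AE \<omega> in M. \<bar>Y t \<omega>\<bar> \<le> C)"

end

theory Submission
  imports Defs
begin

text \<open>On every state \<open>e\<^sub>j\<close> that the chain visits with positive probability, one step of the BSDE
  is the Poisson equation \<open>\<lambda> = f(e\<^sub>j, \<^bold>v) - v(e\<^sub>j) + \<^bold>v\<^sup>* A e\<^sub>j\<close>: the noise \<open>\<^bold>v\<^sup>* X\<^sub>t\<^sub>+\<^sub>1\<close> cancels \<open>v(X\<^sub>t\<^sub>+\<^sub>1)\<close>.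
  Integrating against an invariant law of \<open>A\<close> removes \<open>v\<close> and gives the first formula. Balancedness
  at \<open>(\<^bold>v, 0)\<close> rewrites the Poisson equation as \<open>\<lambda> = f(e\<^sub>j, 0) - v(e\<^sub>j) + \<^bold>v\<^sup>* \<psi>\<^sub>j\<close> with
  \<open>\<psi>\<^sub>j\<close> the columns of another stochastic matrix, and an invariant law of that matrix is \<open>\<pi>\<^sub>v\<close>.
  The laws of \<open>X\<^sub>t\<close> converge to \<open>\<pi>\<close>, so \<open>\<pi>\<close> charges only visited states.\<close>

section \<open>Measures on the state space and their weights\<close>

lemma sum_state_space:
  "(\<Sum>x\<in>(state_space :: (real ^ 'n) set). g x) = (\<Sum>i\<in>UNIV. g (axis i 1))"
  by (simp add: state_space_def sum.reindex[OF inj_axis_one])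

lemma prob_on_states_eq_point_measure:
  assumes "prob_on_states \<mu>"
  shows "\<mu> = point_measure state_space (\<lambda>x. ennreal (measure \<mu> {x}))"
proof (rule measure_eqI_finite)
  interpret prob_space \<mu> using assms by (simp add: prob_on_states_def)
  show "sets \<mu> = Pow state_space" using assms by (simp add: prob_on_states_def)
  show "emeasure \<mu> {a} = emeasure (point_measure state_space (\<lambda>x. ennreal (measure \<mu> {x}))) {a}"
    if "a \<in> state_space" for a
    using that by (simp add: emeasure_point_measure_finite emeasure_eq_measure)
qed (simp_all add: sets_point_measure)

lemma integral_prob_on_states:
  fixes g :: "real ^ 'n \<Rightarrow> real"
  assumes "prob_on_states \<mu>"
  shows "integral\<^sup>L \<mu> g = (\<Sum>x\<in>state_space. g x * measure \<mu> {x})"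
  by (subst prob_on_states_eq_point_measure[OF assms])
    (simp add: lebesgue_integral_point_measure_finite mult.commute)

lemma sum_prob_on_states:
  fixes \<mu> :: "(real ^ 'n) measure"
  assumes "prob_on_states \<mu>"
  shows "(\<Sum>i\<in>UNIV. measure \<mu> {axis i 1}) = 1"
proof -
  interpret prob_space \<mu> using assms by (simp add: prob_on_states_def)
  have "(\<Sum>x\<in>state_space. 1 * measure \<mu> {x}) = integral\<^sup>L \<mu> (\<lambda>_. 1)"
    by (rule integral_prob_on_states[OF assms, symmetric])
  then show ?thesis by (simp add: sum_state_space prob_space)
qed

lemma prob_on_states_of_weights:
  fixes p :: "real ^ 'n"
  assumes nonneg: "\<And>i. 0 \<le> p $ i" and sum: "(\<Sum>i\<in>UNIV. p $ i) = 1"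
  obtains \<mu> where "prob_on_states \<mu>" "\<And>i. measure \<mu> {axis i 1} = p $ i"
proof
  \<comment> \<open>The inner product \<open>x \<bullet> p\<close> reads off the entry of
    \<open>p\<close> belonging to the state \<open>x\<close>, so no inverse of \<open>axis\<close>
    is needed.\<close>
  let ?\<mu> = "point_measure state_space (\<lambda>x. ennreal (x \<bullet> p))"
  have "emeasure ?\<mu> (space ?\<mu>) = 1"
    using nonneg sum
    by (simp add: space_point_measure emeasure_point_measure_finite sum_state_space inner_axis'
        sum_ennreal)
  then show "prob_on_states ?\<mu>"
    by (simp add: prob_on_states_def prob_spaceI sets_point_measure)
  show "measure ?\<mu> {axis i 1} = p $ i" for i
    using nonneg by (simp add: measure_def emeasure_point_measure_finite inner_axis')
qed

section \<open>Invariant vectors and averaging\<close>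

text \<open>Brouwer's fixed point theorem on the probability simplex \<open>?S\<close>, which
  \<open>B\<close> maps into itself because its columns are probability vectors.\<close>

lemma column_stochastic_invariant_vector:
  fixes B :: "real ^ 'n ^ 'n"
  assumes "column_stochastic B"
  obtains p where "\<And>i. 0 \<le> p $ i" "(\<Sum>i\<in>UNIV. p $ i) = 1" "B *v p = p"
proof -
  let ?S = "{p :: real ^ 'n. (\<forall>i. 0 \<le> p $ i) \<and> (\<Sum>i\<in>UNIV. p $ i) = 1}"
  have B: "\<And>i j. 0 \<le> B $ i $ j" "\<And>j. (\<Sum>i\<in>UNIV. B $ i $ j) = 1"
    using assms by (auto simp: column_stochastic_def)
  have "closed ?S"
    by (intro closed_Collect_conj closed_Collect_all closed_Collect_le closed_Collect_eq
        continuous_intros)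
  moreover have "bounded ?S"
  proof (rule boundedI)
    fix p assume "p \<in> ?S"
    then show "norm p \<le> 1" using norm_le_l1_cart[of p] by simp
  qed
  ultimately have "compact ?S" by (simp add: compact_eq_bounded_closed)
  moreover have "convex ?S"
    by (auto simp: convex_def sum.distrib sum_distrib_left[symmetric])
  moreover have "axis (undefined :: 'n) 1 \<in> ?S"
    by (auto simp: axis_def sum.delta')
  then have "?S \<noteq> {}" by blast
  moreover have "continuous_on ?S ((*v) B)"
    by (rule matrix_vector_mult_linear_continuous_on)
  moreover have "(*v) B ` ?S \<subseteq> ?S"
  proof (intro image_subsetI CollectI conjI allI)
    fix p i assume p: "p \<in> ?S"
    then show "0 \<le> (B *v p) $ i" by (auto simp: matrix_vector_mult_def B intro!: sum_nonneg)
    have "(\<Sum>i\<in>UNIV. (B *v p) $ i) = (\<Sum>j\<in>UNIV. (\<Sum>i\<in>UNIV. B $ i $ j) * p $ j)"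
      unfolding matrix_vector_mult_def by (simp add: sum_distrib_right) (rule sum.swap)
    with p show "(\<Sum>i\<in>UNIV. (B *v p) $ i) = 1" by (simp add: B)
  qed
  ultimately obtain p where "p \<in> ?S" "B *v p = p"
    by (rule brouwer[OF _ _ _ _ image_subset_iff_funcset[THEN iffD1]])
  with that show thesis by blast
qed

text \<open>Weighting the equations by \<open>p\<close> and summing, the two terms in
  \<open>w\<close> become \<open>w \<bullet> p\<close> and \<open>w \<bullet> (B *v p)\<close>,
  which cancel by invariance. The equation is asked for only where \<open>p\<close> has mass, since
  it will be known only at visited states.\<close>

lemma poisson_equation_average:
  fixes B :: "real ^ 'n ^ 'n" and p w :: "real ^ 'n"
  assumes inv: "B *v p = p" and sum: "(\<Sum>i\<in>UNIV. p $ i) = 1"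
    and poisson: "\<And>j. p $ j \<noteq> 0 \<Longrightarrow> lam = g j - w $ j + w \<bullet> column j B"
  shows "lam = (\<Sum>j\<in>UNIV. g j * p $ j)"
proof -
  have "lam = (\<Sum>j\<in>UNIV. lam * p $ j)"
    by (simp add: sum_distrib_left[symmetric] sum)
  also have "\<dots> = (\<Sum>j\<in>UNIV. g j * p $ j - w $ j * p $ j + (w \<bullet> column j B) * p $ j)"
  proof (rule sum.cong[OF refl])
    show "lam * p $ j = g j * p $ j - w $ j * p $ j + (w \<bullet> column j B) * p $ j" for j
    proof (cases "p $ j = 0")
      case False
      from poisson[OF this] show ?thesis by (simp only: ring_distribs)
    qed simp
  qed
  also have "\<dots> = (\<Sum>j\<in>UNIV. g j * p $ j) - w \<bullet> p + (\<Sum>j\<in>UNIV. (w \<bullet> column j B) * p $ j)"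
    by (simp add: sum.distrib sum_subtractf inner_vec_def)
  also have "(\<Sum>j\<in>UNIV. (w \<bullet> column j B) * p $ j) = w \<bullet> (B *v p)"
    by (simp add: matrix_mult_sum inner_sum_right scalar_mult_eq_scaleR mult.commute)
  finally show ?thesis by (simp add: inv)
qed

section \<open>Convergence to the ergodic measure\<close>

text \<open>The law of \<open>X t\<close> is the chain law started from the law of
  \<open>X 0\<close>, and one atom differs by at most twice the total variation distance, which
  decays exponentially.\<close>

lemma markov_chain_prob_tendsto_ergodic:
  fixes X :: "nat \<Rightarrow> 'w \<Rightarrow> real ^ 'n"
  assumes mc: "markov_chain M X A" and erg: "ergodic_measure A \<pi>"
  shows "(\<lambda>t. \<P>(\<omega> in M. X t \<omega> = axis i 1)) \<longlonglongrightarrow> measure \<pi> {axis i 1}"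
proof -
  from mc have sp: "state_process M X" by (simp add: markov_chain_def)
  interpret prob_space M using sp by (simp add: state_process_def)
  have [measurable]: "X t \<in> borel_measurable M" for t
    using sp by (simp add: state_process_def)
  let ?law = "\<lambda>t. distr M (count_space state_space) (X t)"
  have meas: "X t \<in> measurable M (count_space state_space)" for t
    unfolding measurable_count_space_eq2[OF finite_state_space]
  proof (intro conjI ballI)
    show "X t \<in> space M \<rightarrow> state_space" using sp by (auto simp: state_process_def)
    show "X t -` {a} \<inter> space M \<in> sets M" for a by measurable
  qed
  have law: "measure (?law t) {axis i 1} = \<P>(\<omega> in M. X t \<omega> = axis i 1)" for t
    using meas by (subst measure_distr) (auto intro: arg_cong[where f = prob])
  from erg obtain R \<rho> where "0 < \<rho>" and
    tv: "\<And>t \<mu>. prob_on_states \<mu> \<Longrightarrow> tv_dist (chain_law A t \<mu>) \<pi> \<le> R * exp (- \<rho> * real t)"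
    unfolding ergodic_measure_def by blast
  have init: "prob_on_states (?law 0)"
    using meas by (simp add: prob_on_states_def prob_space_distr)
  have "\<bar>measure (?law t) {axis i 1} - measure \<pi> {axis i 1}\<bar> \<le> 2 * R * exp (- \<rho> * real t)" for t
  proof -
    have "\<bar>measure (?law t) {axis i 1} - measure \<pi> {axis i 1}\<bar> \<le> 2 * tv_dist (?law t) \<pi>"
      unfolding tv_dist_def using member_le_sum[of "axis i 1" state_space
          "\<lambda>x. \<bar>measure (?law t) {x} - measure \<pi> {x}\<bar>"] by simp
    also have "\<dots> \<le> 2 * R * exp (- \<rho> * real t)"
      using tv[OF init, of t] by (simp add: distr_eq_chain_law[OF mc, of t])
    finally show ?thesis .
  qed
  moreover have "(\<lambda>t. 2 * R * exp (- \<rho> * real t)) \<longlonglongrightarrow> 0"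
    using \<open>0 < \<rho>\<close> by real_asymp
  ultimately show ?thesis
    unfolding law[symmetric] by (subst LIM_zero_iff[symmetric]) (rule Lim_null_comparison, auto)
qed

text \<open>Let t tend to infinity on both sides of the one-step recursion for the state
  probabilities.\<close>

lemma ergodic_measure_invariant:
  fixes X :: "nat \<Rightarrow> 'w \<Rightarrow> real ^ 'n"
  assumes "markov_chain M X A" and "ergodic_measure A \<pi>"
  shows "A *v (\<chi> i. measure \<pi> {axis i 1}) = (\<chi> i. measure \<pi> {axis i 1})"
proof (subst vec_eq_iff, intro allI)
  fix i
  note lim = markov_chain_prob_tendsto_ergodic[OF assms]
  have "(\<lambda>t. \<P>(\<omega> in M. X (Suc t) \<omega> = axis i 1)) \<longlonglongrightarrow>
      (\<Sum>j\<in>UNIV. A $ i $ j * measure \<pi> {axis j 1})"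
    unfolding markov_chain_step[OF assms(1)] by (intro tendsto_intros lim)
  moreover have "(\<lambda>t. \<P>(\<omega> in M. X (Suc t) \<omega> = axis i 1)) \<longlonglongrightarrow> measure \<pi> {axis i 1}"
    using lim by (rule LIMSEQ_Suc)
  ultimately show "(A *v (\<chi> i. measure \<pi> {axis i 1})) $ i = (\<chi> i. measure \<pi> {axis i 1}) $ i"
    by (simp add: matrix_vector_mult_def LIMSEQ_unique)
qed

text \<open>For a negative \<open>a\<close> the ratio is at most 0. A nonzero \<open>a\<close> over
  0 has ratio 0, as division by zero gives 0. A positive lower bound excludes both.\<close>

lemma ratio_pos_lower_boundD:
  assumes "0 < c" "c \<le> ratio a b" "0 \<le> b"
  shows "0 \<le> a" and "b = 0 \<Longrightarrow> a = 0"
proof -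
  show "0 \<le> a"
  proof (rule ccontr)
    assume "\<not> 0 \<le> a"
    then have "ratio a b \<le> 0" using assms(3) by (simp add: ratio_def divide_nonpos_nonneg)
    with assms show False by simp
  qed
  show "a = 0" if "b = 0" using assms that by (simp add: ratio_def split: if_splits)
qed

theorem corollary4p6:
  fixes M :: "'w measure"
    and X :: "nat \<Rightarrow> 'w \<Rightarrow> real ^ 'n"
    and A :: "real ^ 'n ^ 'n"
    and \<gamma> lam :: real
    and f :: "real ^ 'n \<Rightarrow> real ^ 'n \<Rightarrow> real"
    and v :: "real ^ 'n \<Rightarrow> real"
    and vv :: "real ^ 'n"
    and \<pi> :: "(real ^ 'n) measure"
  assumes "markov_chain M X A"
    and "uniformly_ergodic A"
    and "0 < \<gamma>" and "\<gamma> < 1"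
    and "gamma_balanced M X A \<gamma> (\<lambda>\<omega> t z. f (X t \<omega>) z)"
    and "\<And>k. axis k 1 \<bullet> vv = v (axis k 1)"
    and "ebsde_solution M X A (\<lambda>\<omega> t z. f (X t \<omega>) z) (\<lambda>t \<omega>. v (X t \<omega>)) (\<lambda>t \<omega>. vv) lam"
    and "bounded_process M (\<lambda>t \<omega>. v (X t \<omega>))"
    and "ergodic_measure A \<pi>"
  shows "lam = integral\<^sup>L \<pi> (\<lambda>x. f x vv)
    \<and> integral\<^sup>L \<pi> (\<lambda>x. f x vv) = (\<Sum>x\<in>state_space. f x vv * measure \<pi> {x})
    \<and> (\<exists>\<pi>\<^sub>v. prob_on_states \<pi>\<^sub>v \<and> lam = integral\<^sup>L \<pi>\<^sub>v (\<lambda>x. f x 0))"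
proof -

  \<comment> \<open>Visited states and the Poisson equation on them\<close>
  from assms(1) have sp: "state_process M X" and A: "column_stochastic A"
    by (auto simp: markov_chain_def)
  interpret prob_space M using sp by (simp add: state_process_def)
  have [measurable]: "\<And>t. X t \<in> borel_measurable M"
    and st: "\<And>t \<omega>. \<omega> \<in> space M \<Longrightarrow> X t \<omega> \<in> state_space"
    using sp by (auto simp: state_process_def)
  have vv: "vv $ k = v (axis k 1)" for k
    using assms(6)[of k] by (simp add: inner_axis')
  define V where "V = {j. \<exists>t. \<P>(\<omega> in M. X t \<omega> = axis j 1) \<noteq> 0}"
  \<comment> \<open>An event of positive probability is not contained in a null set. This turns
    almost sure statements into statements at one sample point, which suffices for conclusions that
    do not depend on \<omega>.\<close>
  have visit: "\<exists>\<omega>\<in>space M. X t \<omega> = axis j 1 \<and> P \<omega>"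
    if "AE \<omega> in M. P \<omega>" "\<P>(\<omega> in M. X t \<omega> = axis j 1) \<noteq> 0" for P t j
  proof (rule ccontr)
    assume "\<not> ?thesis"
    with that(1) have "AE \<omega> in M. X t \<omega> \<noteq> axis j 1" by (auto elim: AE_mp)
    then have "\<P>(\<omega> in M. X t \<omega> = axis j 1) = 0" by (subst prob_Collect_eq_0) simp_all
    with that(2) show False by simp
  qed
  \<comment> \<open>\<open>V\<close> is closed under transitions: a sum of nonnegative terms with
    one nonzero term is nonzero.\<close>
  have step: "i \<in> V" if "j \<in> V" "A $ i $ j \<noteq> 0" for i j
  proof -
    from that obtain t where t: "\<P>(\<omega> in M. X t \<omega> = axis j 1) \<noteq> 0" by (auto simp: V_def)
    have nonneg: "0 \<le> A $ i $ k * \<P>(\<omega> in M. X t \<omega> = axis k 1)" for k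
      using A by (simp add: column_stochastic_def)
    have "A $ i $ j * \<P>(\<omega> in M. X t \<omega> = axis j 1) \<noteq> 0" using t that by simp
    then have "\<P>(\<omega> in M. X (Suc t) \<omega> = axis i 1) \<noteq> 0"
      unfolding markov_chain_step[OF assms(1)]
      using nonneg by (subst sum_nonneg_eq_0_iff) auto
    then show ?thesis unfolding V_def by blast
  qed
  have poisson: "lam = f (axis j 1) vv - vv $ j + vv \<bullet> column j A" if "j \<in> V" for j
  proof -
    from that obtain t where t: "\<P>(\<omega> in M. X t \<omega> = axis j 1) \<noteq> 0" by (auto simp: V_def)
    have "AE \<omega> in M. v (X (Suc t) \<omega>) = v (X t \<omega>) - (\<Sum>u\<in>{t..<Suc t}. f (X u \<omega>) vv - lam)
        + (\<Sum>u\<in>{t..<Suc t}. vv \<bullet> mart_incr A X u \<omega>)"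
      using assms(7) unfolding ebsde_solution_def by (meson lessI)
    from visit[OF this t] obtain \<omega> where \<omega>: "X t \<omega> = axis j 1" "\<omega> \<in> space M"
      and eq: "v (X (Suc t) \<omega>) = v (X t \<omega>) - (f (X t \<omega>) vv - lam) + vv \<bullet> mart_incr A X t \<omega>"
      by auto
    \<comment> \<open>The successor state \<open>k\<close> is arbitrary: \<open>v\<close> at it
      equals \<open>vv $ k\<close>, which is also its contribution to the martingale term, so it
      drops out.\<close>
    from st[OF \<omega>(2)] obtain k where "X (Suc t) \<omega> = axis k 1" by (auto simp: state_space_def)
    with eq \<omega>(1) show ?thesis
      by (simp add: mart_incr_def inner_diff_right inner_axis vv matrix_vector_mult_basis)
  qed

  \<comment> \<open>The first formula: averaging against \<pi>\<close>
  from assms(9) have pi: "prob_on_states \<pi>" by (simp add: ergodic_measure_def)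
  \<comment> \<open>At an unvisited state the probabilities are constantly 0, and so is their
    limit.\<close>
  have charged: "j \<in> V" if "measure \<pi> {axis j 1} \<noteq> 0" for j
  proof (rule ccontr)
    assume "j \<notin> V"
    with markov_chain_prob_tendsto_ergodic[OF assms(1,9), of j] that show False
      by (simp add: V_def LIMSEQ_const_iff)
  qed
  have "lam = (\<Sum>j\<in>UNIV. f (axis j 1) vv * (\<chi> i. measure \<pi> {axis i 1}) $ j)"
  proof (rule poisson_equation_average[OF ergodic_measure_invariant[OF assms(1,9)]])
    show "(\<Sum>i\<in>UNIV. (\<chi> i. measure \<pi> {axis i 1}) $ i) = 1"
      using sum_prob_on_states[OF pi] by simp
    fix j assume "(\<chi> i. measure \<pi> {axis i 1}) $ j \<noteq> 0"
    then show "lam = f (axis j 1) vv - vv $ j + vv \<bullet> column j A"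
      using poisson charged by simp
  qed
  then have first: "lam = integral\<^sup>L \<pi> (\<lambda>x. f x vv)"
    by (simp add: integral_prob_on_states[OF pi] sum_state_space)

  \<comment> \<open>The second formula: a balanced change of transition matrix\<close>
  from assms(5) obtain \<psi> where \<psi>: "\<And>t z z'. AE \<omega> in M.
        f (X t \<omega>) z - f (X t \<omega>) z' = (z - z') \<bullet> (\<psi> \<omega> t z z' - A *v X t \<omega>) \<and>
        (\<forall>i. ratio (axis i 1 \<bullet> \<psi> \<omega> t z z') (axis i 1 \<bullet> (A *v X t \<omega>)) \<in> {\<gamma>..1 / \<gamma>}) \<and>
        (\<Sum>i\<in>UNIV. \<psi> \<omega> t z z' $ i) = 1"
    unfolding gamma_balanced_def by blast
  \<comment> \<open>The witness is \<psi> for the pair \<open>vv\<close>, \<open>0\<close> at one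
    sample point with \<open>X t\<close> in state \<open>j\<close>. Balancedness transfers zeros of
    column \<open>j\<close> of \<open>A\<close> to it, so its mass stays in
    \<open>V\<close>.\<close>
  have col: "\<exists>b :: real ^ 'n. (\<forall>i. 0 \<le> b $ i \<and> (i \<notin> V \<longrightarrow> b $ i = 0)) \<and> (\<Sum>i\<in>UNIV. b $ i) = 1 \<and>
      lam = f (axis j 1) 0 - vv $ j + vv \<bullet> b" if j: "j \<in> V" for j
  proof -
    from j obtain t where "\<P>(\<omega> in M. X t \<omega> = axis j 1) \<noteq> 0" by (auto simp: V_def)
    from visit[OF \<psi>[of t vv 0] this] obtain \<omega> where
      diff: "f (axis j 1) vv - f (axis j 1) 0 = vv \<bullet> (\<psi> \<omega> t vv 0 - column j A)" and
      rat: "\<And>i. \<gamma> \<le> ratio (\<psi> \<omega> t vv 0 $ i) (A $ i $ j)" and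
      sum: "(\<Sum>i\<in>UNIV. \<psi> \<omega> t vv 0 $ i) = 1"
      by (auto simp: inner_axis' matrix_vector_mult_basis column_def)
    have nonneg: "0 \<le> A $ i $ j" for i using A by (simp add: column_stochastic_def)
    note entry = ratio_pos_lower_boundD[OF assms(3) rat nonneg]
    have "\<psi> \<omega> t vv 0 $ i = 0" if "i \<notin> V" for i
      using entry(2) step[OF j] that by blast
    moreover have "lam = f (axis j 1) 0 - vv $ j + vv \<bullet> \<psi> \<omega> t vv 0"
      using poisson[OF j] diff by (simp add: inner_diff_right)
    ultimately show ?thesis using entry(1) sum by blast
  qed
  have "\<exists>b. \<forall>j\<in>V. (\<forall>i. 0 \<le> b j $ i \<and> (i \<notin> V \<longrightarrow> b j $ i = 0)) \<and> (\<Sum>i\<in>UNIV. b j $ i) = 1 \<and>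
      lam = f (axis j 1) 0 - vv $ j + vv \<bullet> b j"
    by (intro bchoice ballI col)
  then obtain b :: "'n \<Rightarrow> real ^ 'n" where
    b: "\<And>i j. j \<in> V \<Longrightarrow> 0 \<le> b j $ i" "\<And>i j. j \<in> V \<Longrightarrow> i \<notin> V \<Longrightarrow> b j $ i = 0"
      "\<And>j. j \<in> V \<Longrightarrow> (\<Sum>i\<in>UNIV. b j $ i) = 1"
      "\<And>j. j \<in> V \<Longrightarrow> lam = f (axis j 1) 0 - vv $ j + vv \<bullet> b j"
    by blast
  have "\<exists>j. measure \<pi> {axis j 1 :: real ^ 'n} \<noteq> 0"
  proof (rule ccontr)
    assume "\<not> ?thesis"
    then show False using sum_prob_on_states[OF pi] by simp
  qed
  then obtain j0 where j0: "j0 \<in> V" using charged by blast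
  \<comment> \<open>The hypotheses say nothing about unvisited states; giving their columns the value \<open>b j0\<close>
    keeps every invariant law of \<open>B\<close> on \<open>V\<close>.\<close>
  define B :: "real ^ 'n ^ 'n" where "B = (\<chi> i j. b (if j \<in> V then j else j0) $ i)"
  have "column_stochastic B"
    using b(1,3) j0 by (auto simp: column_stochastic_def B_def)
  then obtain p where p: "\<And>i. 0 \<le> p $ i" "(\<Sum>i\<in>UNIV. p $ i) = 1" "B *v p = p"
    using column_stochastic_invariant_vector by blast
  have "lam = (\<Sum>j\<in>UNIV. f (axis j 1) 0 * p $ j)"
  proof (rule poisson_equation_average[OF p(3,2)])
    fix j assume "p $ j \<noteq> 0"
    \<comment> \<open>Every column of \<open>B\<close> vanishes outside \<open>V\<close>, hence so
      does its fixed vector \<open>p\<close>.\<close>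
    moreover have "(B *v p) $ j = 0" if "j \<notin> V"
      using b(2) j0 that by (simp add: matrix_vector_mult_def B_def)
    ultimately have j: "j \<in> V" using p(3) by auto
    then have "column j B = b j" by (simp add: column_def B_def)
    with b(4)[OF j] show "lam = f (axis j 1) 0 - vv $ j + vv \<bullet> column j B" by simp
  qed
  moreover obtain \<mu> where \<mu>: "prob_on_states \<mu>" "\<And>i. measure \<mu> {axis i 1} = p $ i"
    using prob_on_states_of_weights[OF p(1,2)] by blast
  ultimately have "lam = integral\<^sup>L \<mu> (\<lambda>x. f x 0)"
    by (simp add: integral_prob_on_states[OF \<mu>(1)] sum_state_space)
  with first \<mu>(1) integral_prob_on_states[OF pi] show ?thesis by blast
qed

end
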